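(* The structure $\mathbb{F}^{\,r}_{cm}(\mathbb Z)$, the algebra of rational fractions over $\mathbb Z$, is a common meadow that is isomorphic (as a $\Sigma_{cm}$-algebra) to $\mathbb Q_{\mathbf a}$.
   Context: Let $\Sigma_{cm}=\{0,1,\mathbf a,-(\_),(\_)^{-1},+,\cdot\}$ (three constants, two unary and two binary operations). Let $F(\mathbb Z)=\mathbb Z\times\mathbb Z$, whose elements are called fracpairs and written $\frac pq$ (with $q=0$ allowed). Rf-equivalence $=_{rf}$ is the smallest equivalence relation on $F(\mathbb Z)$ such that for all $x,y,z,u\in\mathbb Z$ both $\frac{x\cdot z}{y\cdot(z\cdot z)}=_{rf}\frac{x}{y\cdot z}$ and $\frac{x\cdot(((z\cdot z)+(u\cdot u))+1)}{y\cdot(((z\cdot z)+(u\cdot u))+1)}=_{rf}\frac xy$. On $F(\mathbb Z)$ define: $\frac xy+\frac uv=\frac{x\cdot v+u\cdot y}{y\cdot v}$, $\frac xy\cdot\frac uv=\frac{x\cdot u}{y\cdot v}$, $-\frac xy=\frac{-x}{y}$, $\left(\frac xy\right)^{-1}=\frac{y\cdot y}{x\cdot y}$, $0=\frac01$, $1=\frac11$, $\mathbf a=\frac10$. The relation $=_{rf}$ is a congruence for these operations, and $\mathbb{F}^{\,r}_{cm}(\mathbb Z)$ is the quotient $\Sigma_{cm}$-algebra $F(\mathbb Z)/{=_{rf}}$. $\mathbb Q_{\mathbf a}$ is the $\Sigma_{cm}$-algebra with domain $\mathbb Q\cup\{\mathbf a\}$, $\mathbf a\notin\mathbb Q$, with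 the usual field operations on $\mathbb Q$ (with the usual inverse of nonzero rationals), $0^{-1}=\mathbf a$, $-\mathbf a=\mathbf a^{-1}=\mathbf a$, and $x+\mathbf a=\mathbf a+x=x\cdot\mathbf a=\mathbf a\cdot x=\mathbf a$ for all $x$. A common meadow is a $\Sigma_{cm}$-algebra satisfying, for all $x,y,z$: $(x+y)+z=x+(y+z)$; $x+y=y+x$; $x+0=x$; $x+(-x)=0\cdot x$; $(x\cdot y)\cdot z=x\cdot(y\cdot z)$; $x\cdot y=y\cdot x$; $1\cdot x=x$; $x\cdot(y+z)=x\cdot y+x\cdot z$; $-(-x)=x$; $0\cdot(x\cdot x)=0\cdot x$; $(x^{-1})^{-1}=x+0\cdot x^{-1}$; $x\cdot x^{-1}=1+0\cdot x^{-1}$; $(x\cdot y)^{-1}=x^{-1}\cdot y^{-1}$; $1^{-1}=1$; $0^{-1}=\mathbf a$; $x+\mathbf a=\mathbf a$; $x\cdot\mathbf a=\mathbf a$. *)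

theory Defs
  imports Complex_Main
begin

text \<open>
  A \<open>\<Sigma>\<^sub>c\<^sub>m\<close>-algebra: the domain is the whole type \<open>'a\<close>, the fields are the interpretations of
  \<open>0\<close>, \<open>1\<close>, \<open>a\<close>, \<open>-\<close>, \<open>inverse\<close>, \<open>+\<close>, \<open>\<cdot>\<close>.
\<close>

record 'a cm_algebra =
  cm_zero :: 'a (\<open>\<zero>\<index>\<close>)
  cm_one :: 'a (\<open>\<one>\<index>\<close>)
  cm_err :: 'a (\<open>\<^bold>a\<index>\<close>)
  cm_neg :: "'a \<Rightarrow> 'a" (\<open>\<ominus>\<index> _\<close> [81] 80)
  cm_inv :: "'a \<Rightarrow> 'a" (\<open>inv\<index> _\<close> [81] 80)
  cm_add :: "'a \<Rightarrow> 'a \<Rightarrow> 'a" (infixl \<open>\<oplus>\<index>\<close> 65)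
  cm_mult :: "'a \<Rightarrow> 'a \<Rightarrow> 'a" (infixl \<open>\<otimes>\<index>\<close> 70)

locale common_meadow =
  fixes A :: "'a cm_algebra" (structure)
  assumes add_assoc: "(x \<oplus> y) \<oplus> z = x \<oplus> (y \<oplus> z)"
    and add_comm: "x \<oplus> y = y \<oplus> x"
    and add_zero: "x \<oplus> \<zero> = x"
    and add_neg: "x \<oplus> (\<ominus> x) = \<zero> \<otimes> x"
    and mult_assoc: "(x \<otimes> y) \<otimes> z = x \<otimes> (y \<otimes> z)"
    and mult_comm: "x \<otimes> y = y \<otimes> x"
    and one_mult: "\<one> \<otimes> x = x"
    and distrib: "x \<otimes> (y \<oplus> z) = (x \<otimes> y) \<oplus> (x \<otimes> z)"
    and neg_neg: "\<ominus> (\<ominus> x) = x"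
    and zero_mult_square: "\<zero> \<otimes> (x \<otimes> x) = \<zero> \<otimes> x"
    and inv_inv: "inv (inv x) = x \<oplus> (\<zero> \<otimes> (inv x))"
    and mult_inv: "x \<otimes> (inv x) = \<one> \<oplus> (\<zero> \<otimes> (inv x))"
    and inv_mult: "inv (x \<otimes> y) = (inv x) \<otimes> (inv y)"
    and inv_one: "inv \<one> = \<one>"
    and inv_zero: "inv \<zero> = \<^bold>a"
    and add_err: "x \<oplus> \<^bold>a = \<^bold>a"
    and mult_err: "x \<otimes> \<^bold>a = \<^bold>a"

definition cm_hom :: "'a cm_algebra \<Rightarrow> 'b cm_algebra \<Rightarrow> ('a \<Rightarrow> 'b) \<Rightarrow> bool" where
  "cm_hom A B h \<longleftrightarrow>
     h \<zero>\<^bsub>A\<^esub> = \<zero>\<^bsub>B\<^esub> \<and>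
     h \<one>\<^bsub>A\<^esub> = \<one>\<^bsub>B\<^esub> \<and>
     h \<^bold>a\<^bsub>A\<^esub> = \<^bold>a\<^bsub>B\<^esub> \<and>
     (\<forall>x. h (\<ominus>\<^bsub>A\<^esub> x) = \<ominus>\<^bsub>B\<^esub> (h x)) \<and>
     (\<forall>x. h (inv\<^bsub>A\<^esub> x) = inv\<^bsub>B\<^esub> (h x)) \<and>
     (\<forall>x y. h (x \<oplus>\<^bsub>A\<^esub> y) = h x \<oplus>\<^bsub>B\<^esub> h y) \<and>
     (\<forall>x y. h (x \<otimes>\<^bsub>A\<^esub> y) = h x \<otimes>\<^bsub>B\<^esub> h y)"

definition cm_isomorphic :: "'a cm_algebra \<Rightarrow> 'b cm_algebra \<Rightarrow> bool" where
  "cm_isomorphic A B \<longleftrightarrow> (\<exists>h. bij h \<and> cm_hom A B h)"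


text \<open>
  The fracpair \<open>p/q\<close> is the pair \<open>(p, q)\<close>; \<open>q = 0\<close> is allowed.
\<close>

type_synonym fracpair = "int \<times> int"

inductive rf_eq :: "fracpair \<Rightarrow> fracpair \<Rightarrow> bool" where
  rf_cancel: "rf_eq (x * z, y * (z * z)) (x, y * z)"
| rf_cancel_sum_squares: "rf_eq (x * (((z * z) + (u * u)) + 1), y * (((z * z) + (u * u)) + 1)) (x, y)"
| rf_refl: "rf_eq p p"
| rf_sym: "rf_eq p q \<Longrightarrow> rf_eq q p"
| rf_trans: "rf_eq p q \<Longrightarrow> rf_eq q r \<Longrightarrow> rf_eq p r"

fun fp_add :: "fracpair \<Rightarrow> fracpair \<Rightarrow> fracpair" where
  "fp_add (x, y) (u, v) = (x * v + u * y, y * v)"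

fun fp_mult :: "fracpair \<Rightarrow> fracpair \<Rightarrow> fracpair" where
  "fp_mult (x, y) (u, v) = (x * u, y * v)"

fun fp_neg :: "fracpair \<Rightarrow> fracpair" where
  "fp_neg (x, y) = (- x, y)"

fun fp_inv :: "fracpair \<Rightarrow> fracpair" where
  "fp_inv (x, y) = (y * y, x * y)"

lemma equivp_rf_eq: "equivp rf_eq"
  by (rule equivpI)
    (auto simp: reflp_def symp_def transp_def intro: rf_refl rf_sym rf_trans)

lemma rf_cancel': "a = x * z \<Longrightarrow> b = y * (z * z) \<Longrightarrow> c = x \<Longrightarrow> d = y * z \<Longrightarrow> rf_eq (a, b) (c, d)"
  using rf_cancel by simp

lemma rf_cancel_sum_squares':
  "a = c * (z * z + u * u + 1) \<Longrightarrow> b = d * (z * z + u * u + 1) \<Longrightarrow> rf_eq (a, b) (c, d)"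
  using rf_cancel_sum_squares by simp

lemma rf_eq_add_right: "rf_eq p q \<Longrightarrow> rf_eq (fp_add p r) (fp_add q r)"
proof (induction rule: rf_eq.induct)
  case (rf_cancel x z y)
  obtain u v where r: "r = (u, v)" by fastforce
  show ?case unfolding r fp_add.simps
    by (rule rf_cancel'[where x = "x * v + u * (y * z)" and z = z and y = "y * v"])
      (simp_all add: algebra_simps)
next
  case (rf_cancel_sum_squares x z w y)
  obtain u v where r: "r = (u, v)" by fastforce
  show ?case unfolding r fp_add.simps
    by (rule rf_cancel_sum_squares'[where z = z and u = w]) (simp_all add: algebra_simps)
qed (auto intro: rf_eq.intros)

lemma rf_eq_mult_right: "rf_eq p q \<Longrightarrow> rf_eq (fp_mult p r) (fp_mult q r)"
proof (induction rule: rf_eq.induct)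
  case (rf_cancel x z y)
  obtain u v where r: "r = (u, v)" by fastforce
  show ?case unfolding r fp_mult.simps
    by (rule rf_cancel'[where x = "x * u" and z = z and y = "y * v"])
      (simp_all add: algebra_simps)
next
  case (rf_cancel_sum_squares x z w y)
  obtain u v where r: "r = (u, v)" by fastforce
  show ?case unfolding r fp_mult.simps
    by (rule rf_cancel_sum_squares'[where z = z and u = w]) (simp_all add: algebra_simps)
qed (auto intro: rf_eq.intros)

lemma rf_eq_neg: "rf_eq p q \<Longrightarrow> rf_eq (fp_neg p) (fp_neg q)"
proof (induction rule: rf_eq.induct)
  case (rf_cancel x z y)
  show ?case unfolding fp_neg.simps
    by (rule rf_cancel'[where x = "- x" and z = z and y = y]) simp_all
next
  case (rf_cancel_sum_squares x z w y)
  show ?case unfolding fp_neg.simps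
    by (rule rf_cancel_sum_squares'[where z = z and u = w]) (simp_all add: algebra_simps)
qed (auto intro: rf_eq.intros)

lemma rf_eq_inv: "rf_eq p q \<Longrightarrow> rf_eq (fp_inv p) (fp_inv q)"
proof (induction rule: rf_eq.induct)
  case (rf_cancel x z y)
  have "rf_eq (fp_inv (x * z, y * (z * z))) (y * y * z * z * z, x * y * z * z)"
    unfolding fp_inv.simps
    by (rule rf_cancel'[where x = "y * y * z * z * z" and z = z and y = "x * y * z"])
      (simp_all add: algebra_simps)
  moreover have "rf_eq (y * y * z * z * z, x * y * z * z) (fp_inv (x, y * z))"
    unfolding fp_inv.simps
    by (rule rf_cancel'[where x = "y * y * z * z" and z = z and y = "x * y"])
      (simp_all add: algebra_simps)
  ultimately show ?case by (rule rf_trans)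
next
  case (rf_cancel_sum_squares x z w y)
  let ?s = "z * z + w * w + 1"
  have "rf_eq (fp_inv (x * ?s, y * ?s)) (y * y * ?s, x * y * ?s)"
    unfolding fp_inv.simps
    by (rule rf_cancel_sum_squares'[where z = z and u = w]) (simp_all add: algebra_simps)
  moreover have "rf_eq (y * y * ?s, x * y * ?s) (fp_inv (x, y))"
    unfolding fp_inv.simps by (rule rf_eq.rf_cancel_sum_squares)
  ultimately show ?case by (rule rf_trans)
qed (auto intro: rf_eq.intros)

lemma fp_add_comm: "fp_add p q = fp_add q p"
  by (cases p; cases q) (simp add: algebra_simps)

lemma fp_mult_comm: "fp_mult p q = fp_mult q p"
  by (cases p; cases q) (simp add: algebra_simps)

lemma rf_eq_add: "rf_eq p q \<Longrightarrow> rf_eq r s \<Longrightarrow> rf_eq (fp_add p r) (fp_add q s)"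
  by (metis fp_add_comm rf_eq_add_right rf_trans)

lemma rf_eq_mult: "rf_eq p q \<Longrightarrow> rf_eq r s \<Longrightarrow> rf_eq (fp_mult p r) (fp_mult q s)"
  by (metis fp_mult_comm rf_eq_mult_right rf_trans)

quotient_type rational_fraction = fracpair / rf_eq
  by (rule equivp_rf_eq)

lift_definition rf_zero :: rational_fraction is "(0, 1)" .
lift_definition rf_one :: rational_fraction is "(1, 1)" .
lift_definition rf_err :: rational_fraction is "(1, 0)" .
lift_definition rf_neg :: "rational_fraction \<Rightarrow> rational_fraction" is fp_neg
  by (rule rf_eq_neg)
lift_definition rf_inv :: "rational_fraction \<Rightarrow> rational_fraction" is fp_inv
  by (rule rf_eq_inv)
lift_definition rf_add :: "rational_fraction \<Rightarrow> rational_fraction \<Rightarrow> rational_fraction" is fp_add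
  by (rule rf_eq_add)
lift_definition rf_mult :: "rational_fraction \<Rightarrow> rational_fraction \<Rightarrow> rational_fraction" is fp_mult
  by (rule rf_eq_mult)

definition rational_fractions :: "rational_fraction cm_algebra" where
  "rational_fractions = \<lparr>cm_zero = rf_zero, cm_one = rf_one, cm_err = rf_err,
     cm_neg = rf_neg, cm_inv = rf_inv, cm_add = rf_add, cm_mult = rf_mult\<rparr>"


text \<open>
  The domain of \<open>\<rat>\<^sub>a\<close> is \<open>rat option\<close>, with \<open>None\<close> as the additional element \<open>a\<close>.
\<close>

fun qa_neg :: "rat option \<Rightarrow> rat option" where
  "qa_neg (Some p) = Some (- p)"
| "qa_neg None = None"

fun qa_inv :: "rat option \<Rightarrow> rat option" where
  "qa_inv (Some p) = (if p = 0 then None else Some (inverse p))"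
| "qa_inv None = None"

fun qa_add :: "rat option \<Rightarrow> rat option \<Rightarrow> rat option" where
  "qa_add (Some p) (Some q) = Some (p + q)"
| "qa_add _ _ = None"

fun qa_mult :: "rat option \<Rightarrow> rat option \<Rightarrow> rat option" where
  "qa_mult (Some p) (Some q) = Some (p * q)"
| "qa_mult _ _ = None"

definition rat_a :: "rat option cm_algebra" where
  "rat_a = \<lparr>cm_zero = Some 0, cm_one = Some 1, cm_err = None,
     cm_neg = qa_neg, cm_inv = qa_inv, cm_add = qa_add, cm_mult = qa_mult\<rparr>"

end

theory Submission
  imports Defs "HOL-Computational_Algebra.Primes"
begin

text \<open>
  Two fracpairs are rf-equivalent iff they have the same value in \<open>\<rat>\<^sub>a\<close>. If \<open>m\<close> divides some
  \<open>s = z\<^sup>2 + u\<^sup>2 + 1\<close>, say \<open>s = m w\<close>, then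
  \<open>xm/ym = xms/yms = (xmw)m/(yw)mm = xmw/ywm = xs/ys = x/y\<close>, so \<open>m\<close> may be cancelled.
  Every prime divides such an \<open>s\<close> by a pigeonhole argument, hence all nonzero integers cancel.
\<close>

text \<open>Equal squares make the prime \<open>p\<close> divide \<open>x - y\<close> or
  \<open>x + y\<close>. Both have absolute value at most \<open>2 * k\<close>, below
  \<open>p\<close>, so the one divided is zero; \<open>x + y = 0\<close> forces both to be
  0.\<close>

lemma inj_on_square_mod_prime:
  fixes p k :: int
  assumes "prime p" "p = 2 * k + 1"
  shows "inj_on (\<lambda>z. z * z mod p) {0..k}"
proof (rule inj_onI)
  fix x y assume xy: "x \<in> {0..k}" "y \<in> {0..k}" and "x * x mod p = y * y mod p"
  then have "p dvd (x - y) * (x + y)"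
    by (simp add: mod_eq_dvd_iff algebra_simps)
  then consider "p dvd x - y" | "p dvd x + y"
    using assms(1) prime_dvd_mult_iff by blast
  then show "x = y"
  proof cases
    case 1
    then show ?thesis
      using xy assms(2) zdvd_imp_le[of p "x - y"] zdvd_imp_le[of p "y - x"]
      by (cases x y rule: linorder_cases) (auto simp: dvd_diff_commute)
  next
    case 2
    then show ?thesis
      using xy assms(2) zdvd_imp_le[of p "x + y"] by (cases "x + y > 0") auto
  qed
qed

lemma prime_dvd_sum_two_squares_plus_one:
  fixes p :: int
  assumes "prime p"
  shows "\<exists>z u. p dvd z * z + u * u + 1"
proof (cases "even p")
  case True
  then have "p = 2"
    using assms primes_dvd_imp_eq[of 2 p] by simp
  \<comment> \<open>The counting below relies on \<open>p\<close> being odd, so 2 gets an explicit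
    witness.\<close>
  then have "p dvd 1 * 1 + 0 * 0 + 1" by simp
  then show ?thesis by blast
next
  case False
  then obtain k where p: "p = 2 * k + 1" by (elim oddE)
  have k: "k \<ge> 0" using p prime_gt_0_int[OF assms] by linarith
  define A where "A = (\<lambda>z. z * z mod p) ` {0..k}"
  define B where "B = (\<lambda>u. (- 1 - u * u) mod p) ` {0..k}"
  have "card A = nat (k + 1)"
    unfolding A_def using inj_on_square_mod_prime[OF assms p] by (simp add: card_image)
  moreover have "inj_on (\<lambda>u. (- 1 - u * u) mod p) {0..k}"
  proof (rule inj_onI)
    fix x y assume "x \<in> {0..k}" "y \<in> {0..k}" "(- 1 - x * x) mod p = (- 1 - y * y) mod p"
    moreover from this have "x * x mod p = y * y mod p"
      by (simp add: mod_eq_dvd_iff dvd_diff_commute)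
    ultimately show "x = y"
      using inj_on_square_mod_prime[OF assms p] by (auto dest: inj_onD)
  qed
  then have "card B = nat (k + 1)"
    unfolding B_def by (simp add: card_image)
  moreover have "A \<union> B \<subseteq> {0..<p}"
    using prime_gt_0_int[OF assms] by (auto simp: A_def B_def)
  then have "card (A \<union> B) \<le> nat p"
    using card_mono[of "{0..<p}" "A \<union> B"] by simp
  moreover have "finite A" "finite B" by (auto simp: A_def B_def)
  \<comment> \<open>Disjoint \<open>A\<close> and \<open>B\<close> would have
    \<open>2 * (k + 1) = p + 1\<close> elements among only \<open>p\<close> residues.\<close>
  ultimately have "A \<inter> B \<noteq> {}"
    using card_Un_disjoint[of A B] p k by force
  then obtain z u where "z * z mod p = (- 1 - u * u) mod p"
    by (auto simp: A_def B_def)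
  then have "p dvd z * z + u * u + 1"
    by (simp add: mod_eq_dvd_iff algebra_simps)
  then show ?thesis by blast
qed

lemma rf_eq_cancel_divisor:
  assumes "m dvd z * z + u * u + 1"
  shows "rf_eq (x * m, y * m) (x, y)"
proof -
  obtain w where w: "z * z + u * u + 1 = m * w" using assms by (elim dvdE)
  have scale: "rf_eq (c, d) (c * (m * w), d * (m * w))" for c d
    using rf_cancel_sum_squares[of c z u d] w by (simp add: rf_sym)
  \<comment> \<open>Scaling by \<open>m * w\<close> has put a second \<open>m\<close> into the
    denominator, which is the square that \<open>rf_cancel\<close> requires.\<close>
  have "rf_eq (x * m * (m * w), y * m * (m * w)) (x * (m * w), y * (m * w))"
    by (rule rf_cancel'[where x = "x * m * w" and z = m and y = "y * w"]) simp_all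
  then show ?thesis
    using scale rf_sym rf_trans by blast
qed

lemma rf_eq_cancel:
  assumes "m \<noteq> 0"
  shows "rf_eq (x * m, y * m) (x, y)"
  using assms
proof (induction m arbitrary: x y rule: prime_divisors_induct)
  case zero
  then show ?case by simp
next
  case (unit m)
  \<comment> \<open>A unit divides 1, the value of the form at \<open>z = u = 0\<close>.\<close>
  then have "m dvd 0 * 0 + 0 * 0 + 1" by simp
  then show ?case by (rule rf_eq_cancel_divisor)
next
  case (factor p m)
  obtain z u where "p dvd z * z + u * u + 1"
    using prime_dvd_sum_two_squares_plus_one[OF factor.hyps(1)] by blast
  then have "rf_eq (x * m * p, y * m * p) (x * m, y * m)"
    by (rule rf_eq_cancel_divisor)
  moreover have "rf_eq (x * m, y * m) (x, y)"
    using factor by simp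
  ultimately have "rf_eq (x * m * p, y * m * p) (x, y)"
    by (rule rf_trans)
  then show ?case by (simp add: mult_ac)
qed

fun fp_value :: "fracpair \<Rightarrow> rat option" where
  "fp_value (x, y) = (if y = 0 then None else Some (of_int x / of_int y))"

lemma rf_eq_iff_value_eq: "rf_eq p q \<longleftrightarrow> fp_value p = fp_value q"
proof
  assume "rf_eq p q"
  then show "fp_value p = fp_value q"
  proof (induction rule: rf_eq.induct)
    case (rf_cancel_sum_squares x z u y)
    \<comment> \<open>Positivity makes the common factor cancellable in the rationals; it is kept as
      one integer so that it cancels as a whole.\<close>
    have "z * z + u * u + 1 > 0"
      by (simp add: add_nonneg_pos)
    then have "z * z + u * u + 1 \<noteq> 0" by linarith
    then show ?case
      by (simp del: of_int_add of_int_mult add: of_int_mult[of _ "z * z + u * u + 1"])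
  qed auto
next
  assume eq: "fp_value p = fp_value q"
  obtain x y u v where pq: "p = (x, y)" "q = (u, v)" by fastforce
  show "rf_eq p q"
  proof (cases "y = 0")
    case True
    then have "v = 0" using eq pq by (simp split: if_splits)
    \<comment> \<open>With \<open>z = 0\<close> the first rule erases the numerator, so all
      fracpairs with denominator 0 fall into one class.\<close>
    have "rf_eq (0, 0) (c, 0)" for c
      using rf_cancel[of c 0 0] by simp
    then show ?thesis
      using pq True \<open>v = 0\<close> rf_sym rf_trans by blast
  next
    case False
    then have v: "v \<noteq> 0" and "(of_int x / of_int y :: rat) = of_int u / of_int v"
      using eq pq by (auto split: if_splits)
    then have "(of_int (x * v) :: rat) = of_int (u * y)"
      using False by (simp add: frac_eq_eq)
    then have "x * v = u * y" by (simp only: of_int_eq_iff)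
    \<comment> \<open>Both fracpairs are compared over the common denominator \<open>v * y\<close>,
      where their numerators agree.\<close>
    then have "rf_eq (x, y) (u * y, v * y)"
      using rf_eq_cancel[OF v, of x y] by (simp add: rf_sym mult.commute)
    then show ?thesis
      using rf_eq_cancel[OF False, of u v] pq rf_trans by blast
  qed
qed

text \<open>This is the isomorphism: one direction of \<open>rf_eq_iff_value_eq\<close> makes it
  well defined, the other injective.\<close>

lift_definition rf_value :: "rational_fraction \<Rightarrow> rat option" is fp_value
  by (simp add: rf_eq_iff_value_eq)

lemma inj_rf_value: "inj rf_value"
  by (rule injI, transfer) (simp add: rf_eq_iff_value_eq)

lemma surj_rf_value: "surj rf_value"
  unfolding surj_def
proof
  fix r
  show "\<exists>f. r = rf_value f"
  proof (cases r)
    case None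
    then have "r = rf_value rf_err" by transfer simp
    then show ?thesis ..
  next
    case (Some t)
    obtain a b where "t = Fract a b" "b > 0" by (cases t) auto
    then have "r = fp_value (a, b)" using Some by (simp add: Fract_of_int_quotient)
    also have "\<dots> = rf_value (abs_rational_fraction (a, b))"
      by (simp add: rf_value.abs_eq)
    finally show ?thesis ..
  qed
qed

lemma cm_hom_rf_value: "cm_hom rational_fractions rat_a rf_value"
  unfolding cm_hom_def rational_fractions_def rat_a_def cm_algebra.simps
proof (intro conjI allI; transfer)
  fix p q :: fracpair
  obtain x y u v where pq: "p = (x, y)" "q = (u, v)" by fastforce
  \<comment> \<open>For the inverse, the denominator \<open>x * y\<close> vanishes exactly when the
    value of \<open>p\<close> is \<open>Some 0\<close> or \<open>None\<close>, the two arguments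
    that \<open>qa_inv\<close> sends to \<open>None\<close>.\<close>
  show "fp_value (fp_neg p) = qa_neg (fp_value p)"
    and "fp_value (fp_inv p) = qa_inv (fp_value p)"
    and "fp_value (fp_add p q) = qa_add (fp_value p) (fp_value q)"
    and "fp_value (fp_mult p q) = qa_mult (fp_value p) (fp_value q)"
    by (simp_all add: pq add_frac_eq)
qed auto

lemma common_meadow_rat_a: "common_meadow rat_a"
proof (unfold_locales, unfold rat_a_def cm_algebra.simps)
  fix x y z :: "rat option"
  show "qa_add (qa_add x y) z = qa_add x (qa_add y z)"
    and "qa_mult (qa_mult x y) z = qa_mult x (qa_mult y z)"
    and "qa_mult x (qa_add y z) = qa_add (qa_mult x y) (qa_mult x z)"
    by (cases x; cases y; cases z; simp add: algebra_simps)+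
  show "qa_add x y = qa_add y x" and "qa_mult x y = qa_mult y x"
    and "qa_inv (qa_mult x y) = qa_mult (qa_inv x) (qa_inv y)"
    by (cases x; cases y; simp)+
next
  fix x :: "rat option"
  show "qa_add x (Some 0) = x" and "qa_add x (qa_neg x) = qa_mult (Some 0) x"
    and "qa_mult (Some 1) x = x" and "qa_neg (qa_neg x) = x"
    and "qa_mult (Some 0) (qa_mult x x) = qa_mult (Some 0) x"
    and "qa_inv (qa_inv x) = qa_add x (qa_mult (Some 0) (qa_inv x))"
    and "qa_mult x (qa_inv x) = qa_add (Some 1) (qa_mult (Some 0) (qa_inv x))"
    and "qa_add x None = None" and "qa_mult x None = None"
    by (cases x; simp)+
qed auto

text \<open>All axioms are equations: applying \<open>h\<close> to both sides turns each into an
  instance of the same axiom in \<open>B\<close>, and injectivity pulls it back to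
  \<open>A\<close>.\<close>

lemma common_meadow_inj_hom:
  assumes B: "common_meadow B" and h: "cm_hom A B h" and inj: "inj h"
  shows "common_meadow A"
proof -
  interpret B: common_meadow B by (rule B)
  have hom:
    "h (cm_zero A) = cm_zero B" "h (cm_one A) = cm_one B" "h (cm_err A) = cm_err B"
    "h (cm_neg A x) = cm_neg B (h x)" "h (cm_inv A x) = cm_inv B (h x)"
    "h (cm_add A x y) = cm_add B (h x) (h y)" "h (cm_mult A x y) = cm_mult B (h x) (h y)" for x y
    using h by (simp_all add: cm_hom_def)
  show ?thesis
    by (unfold_locales; rule injD[OF inj]; unfold hom)
      (rule B.add_assoc B.add_comm B.add_zero B.add_neg B.mult_assoc B.mult_comm B.one_mult
        B.distrib B.neg_neg B.zero_mult_square B.inv_inv B.mult_inv B.inv_mult B.inv_one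
        B.inv_zero B.add_err B.mult_err)+
qed

theorem theorem3p3p3:
  shows "common_meadow rational_fractions \<and> cm_isomorphic rational_fractions rat_a"
proof
  show "common_meadow rational_fractions"
    using common_meadow_rat_a cm_hom_rf_value inj_rf_value by (rule common_meadow_inj_hom)
  show "cm_isomorphic rational_fractions rat_a"
    unfolding cm_isomorphic_def using cm_hom_rf_value inj_rf_value surj_rf_value
    by (auto simp: bij_def)
qed

end
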